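(* Let $\Gamma$ be a countable group. Assume that $N\lhd\Gamma$ is a normal subgroup contained in the hypercentre of $\Gamma$ and let $\phi:\Gamma\to\Gamma/N$ be the quotient map. Let $\nu$ be a finitely supported symmetric probability measure on $\Gamma/N$ whose support generates $\Gamma/N$. Let $\mu$ be any probability measure on $\Gamma$ such that $\operatorname{supp}\mu\cap N$ generates $N$ and such that $\phi_*\mu$ is a lazy version of $\nu$. Assume that at least one of the following holds: (a) $N$ is finitely generated; or (b) there exists $n\geq 1$ such that for every ordinal $\lambda$ the set $\operatorname{supp}(\mu^{*n})\cap N\cap Z^\lambda(\Gamma)$ generates $N\cap Z^\lambda(\Gamma)$. Then $\Gamma$ is $\mu$-Liouville if and only if $\Gamma/N$ is $\nu$-Liouville.
   Context: Measures are probability measures on countable (discrete) groups. For a probability measure $P$ on a countable group $G$ and a bounded function $f:G\to\mathbb{R}$, put $(f*P)(\gamma)=\sum_{y\in G} f(\gamma y^{-1})P(y)$. The function $f$ is $P$-harmonic if $f*P=f$. The group $G$ is $P$-Liouville if every bounded $P$-harmonic function on $G$ is constant. $\mu^{*n}$ is the $n$-fold convolution power of $\mu$. A measure $\nu$ is symmetric if $\nu(x)=\nu(x^{-1})$ for all $x$. "Generates" means generates as a group. The push-forward of $\mu$ by $\phi$ is $\phi_*\mu(x)=\mu(\phi^{-1}(x))$. A measure $\mu'$ on a group $G$ is a lazy version of $\nu$ if there is $t\in[0,1)$ with $\mu' = t\delta_e+(1-t)\nu$, where $\delta_e$ is the Dirac mass at the identity. Hypercentre: put $Z^0(\Gamma)=\{e\}$.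 For each ordinal $\lambda$, $Z^{\lambda+1}(\Gamma)$ is the preimage in $\Gamma$ of the centre of $\Gamma/Z^\lambda(\Gamma)$. For a limit ordinal $\beta$, $Z^\beta(\Gamma)=\bigcup_{\lambda<\beta}Z^\lambda(\Gamma)$. This sequence stabilises at some ordinal $\alpha$, and $Z^\alpha(\Gamma)$ is the hypercentre of $\Gamma$. *)

theory Defs
  imports
    "HOL-Algebra.Coset"
    "HOL-Algebra.Generated_Groups"
    "HOL-Probability.Probability_Mass_Function"
    "HOL-Analysis.Infinite_Sum"
begin

unbundle cardinal_syntax

text \<open>A probability measure on a countable group \<open>G\<close> is a pmf whose support lies in
  \<open>carrier G\<close>.\<close>

definition prob_measure_on :: "('a, 'b) monoid_scheme \<Rightarrow> 'a pmf \<Rightarrow> bool" where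
  "prob_measure_on G P \<longleftrightarrow> set_pmf P \<subseteq> carrier G"

definition symmetric_measure :: "('a, 'b) monoid_scheme \<Rightarrow> 'a pmf \<Rightarrow> bool" where
  "symmetric_measure G P \<longleftrightarrow> (\<forall>x\<in>carrier G. pmf P x = pmf P (inv\<^bsub>G\<^esub> x))"

definition lazy_version :: "('a, 'b) monoid_scheme \<Rightarrow> 'a pmf \<Rightarrow> 'a pmf \<Rightarrow> bool" where
  "lazy_version G P Q \<longleftrightarrow>
     (\<exists>t::real. 0 \<le> t \<and> t < 1 \<and>
        (\<forall>x\<in>carrier G. pmf P x = t * pmf (return_pmf \<one>\<^bsub>G\<^esub>) x + (1 - t) * pmf Q x))"

text \<open>The convolution of two measures is the law of the product of independent samples, so its
  mass at \<open>g\<close> is the sum of \<open>P (g \<otimes> inv y) * Q y\<close> over \<open>y\<close>.\<close>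

definition conv_pmf :: "('a, 'b) monoid_scheme \<Rightarrow> 'a pmf \<Rightarrow> 'a pmf \<Rightarrow> 'a pmf" where
  "conv_pmf G P Q = map_pmf (\<lambda>(x, y). x \<otimes>\<^bsub>G\<^esub> y) (pair_pmf P Q)"

primrec conv_power :: "('a, 'b) monoid_scheme \<Rightarrow> 'a pmf \<Rightarrow> nat \<Rightarrow> 'a pmf" where
  "conv_power G P 0 = return_pmf \<one>\<^bsub>G\<^esub>"
| "conv_power G P (Suc n) = conv_pmf G (conv_power G P n) P"

definition conv_fun :: "('a, 'b) monoid_scheme \<Rightarrow> ('a \<Rightarrow> real) \<Rightarrow> 'a pmf \<Rightarrow> 'a \<Rightarrow> real" where
  "conv_fun G f P g = (\<Sum>\<^sub>\<infinity>y\<in>carrier G. f (g \<otimes>\<^bsub>G\<^esub> inv\<^bsub>G\<^esub> y) * pmf P y)"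

definition harmonic :: "('a, 'b) monoid_scheme \<Rightarrow> 'a pmf \<Rightarrow> ('a \<Rightarrow> real) \<Rightarrow> bool" where
  "harmonic G P f \<longleftrightarrow> (\<forall>g\<in>carrier G. conv_fun G f P g = f g)"

definition liouville :: "('a, 'b) monoid_scheme \<Rightarrow> 'a pmf \<Rightarrow> bool" where
  "liouville G P \<longleftrightarrow>
     (\<forall>f::'a \<Rightarrow> real. bounded (f ` carrier G) \<longrightarrow> harmonic G P f \<longrightarrow>
        (\<exists>c. \<forall>x\<in>carrier G. f x = c))"

definition group_centre :: "('a, 'b) monoid_scheme \<Rightarrow> 'a set" where
  "group_centre G = {z \<in> carrier G. \<forall>x\<in>carrier G. z \<otimes>\<^bsub>G\<^esub> x = x \<otimes>\<^bsub>G\<^esub> z}"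

definition centre_preimage :: "('a, 'b) monoid_scheme \<Rightarrow> 'a set \<Rightarrow> 'a set" where
  "centre_preimage G Z = {x \<in> carrier G. Z #>\<^bsub>G\<^esub> x \<in> group_centre (G Mod Z)}"

text \<open>There is no type of all ordinals in HOL. We index the upper central series of \<open>G\<close> by the
  elements of the well-order \<open>ordinals_for G\<close>, whose order type is the least cardinal exceeding
  both \<open>\<aleph>\<^sub>0\<close> and the cardinality of \<open>G\<close> (so \<open>\<omega>\<^sub>1\<close> if \<open>G\<close> is countable): its elements
  stand for all the ordinals below that cardinal. The series strictly increases until it
  stabilises, so it stabilises at one of these ordinals
  (see \<open>upper_central_stabilises\<close> below), and every term of the series over all ordinals already
  occurs among them.\<close>

definition ordinals_for :: "('a, 'b) monoid_scheme \<Rightarrow> (nat + 'a) set rel" where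
  "ordinals_for G = cardSuc (natLeq +c |carrier G| )"

text \<open>In a well-order \<open>r\<close>, the element \<open>i\<close> is the successor of \<open>j\<close> iff the elements strictly
  below \<open>i\<close> are those below or equal to \<open>j\<close>.\<close>

definition upper_central_step ::
    "('a, 'b) monoid_scheme \<Rightarrow> 'o rel \<Rightarrow> ('o \<Rightarrow> 'a set) \<Rightarrow> 'o \<Rightarrow> 'a set" where
  "upper_central_step G r Z i =
     (if underS r i = {} then {\<one>\<^bsub>G\<^esub>}
      else if \<exists>j. underS r i = under r j
        then centre_preimage G (Z (THE j. underS r i = under r j))
      else (\<Union>j\<in>underS r i. Z j))"

definition upper_central :: "('a, 'b) monoid_scheme \<Rightarrow> (nat + 'a) set \<Rightarrow> 'a set" where
  "upper_central G = wo_rel.worec (ordinals_for G) (upper_central_step G (ordinals_for G))"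

definition hypercentre :: "('a, 'b) monoid_scheme \<Rightarrow> 'a set" where
  "hypercentre G =
     (THE H. \<exists>\<alpha>\<in>Field (ordinals_for G). \<forall>\<beta>\<in>Field (ordinals_for G).
        (\<alpha>, \<beta>) \<in> ordinals_for G \<longrightarrow> upper_central G \<beta> = H)"


subsection \<open>Recursion equations and stabilisation of the upper central series\<close>

lemma Card_order_ordinals_for: "Card_order (ordinals_for G)"
  unfolding ordinals_for_def by (intro cardSuc_Card_order Card_order_csum)

lemma wo_rel_ordinals_for: "wo_rel (ordinals_for G)"
  using Card_order_ordinals_for[of G] unfolding wo_rel_def card_order_on_def by blast

lemma ordinals_for_greater: "|carrier G| <o ordinals_for G"
  unfolding ordinals_for_def
  by (rule ordLeq_ordLess_trans[OF ordLeq_csum2[OF card_of_Card_order]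
        cardSuc_greater[OF Card_order_csum]])

context wo_rel
begin

lemma successor_unique:
  assumes "underS i = under j" "underS i = under k" "underS i \<noteq> {}"
  shows "j = k"
proof -
  have F: "j \<in> Field r" "k \<in> Field r"
    using assms by (auto simp: under_def Field_def)
  then have "j \<in> under j" "k \<in> under k"
    using REFL by (auto simp: under_def refl_on_def)
  then have "(j, k) \<in> r" "(k, j) \<in> r"
    using assms by (auto simp: under_def)
  then show ?thesis using ANTISYM by (auto simp: antisym_def)
qed

lemma successor_the:
  assumes "underS i = under j" "underS i \<noteq> {}"
  shows "(THE j. underS i = under j) = j"
  using assms successor_unique by (intro the_equality) auto

lemma successor_below:
  assumes "underS i = under j" "underS i \<noteq> {}"
  shows "j \<in> underS i"
proof -
  have "j \<in> Field r" using assms by (auto simp: under_def Field_def)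
  then have "j \<in> under j" using REFL by (auto simp: under_def refl_on_def)
  with assms show ?thesis by simp
qed

lemma adm_upper_central_step: "adm_wo (upper_central_step G r)"
  unfolding adm_wo_def
proof (intro allI impI)
  fix f g :: "'a \<Rightarrow> 'b set" and i
  assume eq: "\<forall>j\<in>underS i. f j = g j"
  show "upper_central_step G r f i = upper_central_step G r g i"
  proof (cases "underS i \<noteq> {} \<and> (\<exists>j. underS i = under j)")
    case True
    then obtain j where j: "underS i = under j" "underS i \<noteq> {}" by blast
    have "f (THE j. underS i = under j) = g (THE j. underS i = under j)"
      using eq successor_below[OF j] unfolding successor_the[OF j] by blast
    with True show ?thesis unfolding upper_central_step_def by presburger
  next
    case False
    have "(\<Union>j\<in>underS i. f j) = (\<Union>j\<in>underS i. g j)" using eq by auto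
    with False show ?thesis unfolding upper_central_step_def by presburger
  qed
qed

end

lemma upper_central_unfold:
  "upper_central G i = upper_central_step G (ordinals_for G) (upper_central G) i"
  using wo_rel.worec_fixpoint[OF wo_rel_ordinals_for wo_rel.adm_upper_central_step[OF wo_rel_ordinals_for]]
  unfolding upper_central_def by metis

lemma upper_central_zero:
  assumes "underS (ordinals_for G) i = {}"
  shows "upper_central G i = {\<one>\<^bsub>G\<^esub>}"
  using assms by (subst upper_central_unfold) (simp add: upper_central_step_def)

lemma upper_central_successor:
  assumes "underS (ordinals_for G) i = under (ordinals_for G) j" "j \<in> Field (ordinals_for G)"
  shows "upper_central G i = centre_preimage G (upper_central G j)"
proof -
  interpret wo_rel "ordinals_for G" by (rule wo_rel_ordinals_for)
  have "underS i \<noteq> {}"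
    using assms REFL by (auto simp: under_def refl_on_def)
  then show ?thesis
    using assms successor_the[OF assms(1)]
    by (subst upper_central_unfold) (auto simp: upper_central_step_def)
qed

lemma upper_central_limit:
  assumes "underS (ordinals_for G) i \<noteq> {}"
    and "\<nexists>j. underS (ordinals_for G) i = under (ordinals_for G) j"
  shows "upper_central G i = (\<Union>j\<in>underS (ordinals_for G) i. upper_central G j)"
  using assms by (subst upper_central_unfold) (simp add: upper_central_step_def)

lemma (in group) commute_inv:
  assumes "c \<in> carrier G" "q \<in> carrier G" "c \<otimes> q = q \<otimes> c"
  shows "inv c \<otimes> q = q \<otimes> inv c"
proof -
  have "inv c \<otimes> q = inv c \<otimes> (q \<otimes> c) \<otimes> inv c"
    using assms(1,2) by (simp add: m_assoc)
  also have "\<dots> = inv c \<otimes> (c \<otimes> q) \<otimes> inv c"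
    using assms(3) by simp
  also have "\<dots> = q \<otimes> inv c"
    using assms(1,2) by (simp flip: m_assoc)
  finally show ?thesis .
qed

lemma centre_preimage_normal:
  assumes "Z \<lhd> G"
  shows "centre_preimage G Z \<lhd> G" and "Z \<subseteq> centre_preimage G Z"
proof -
  interpret normal Z G by (rule assms)
  let ?p = "\<lambda>x. Z #>\<^bsub>G\<^esub> x"
  let ?Q = "G Mod Z"
  interpret Q: group ?Q by (rule factorgroup_is_group)
  interpret h: group_hom G ?Q ?p
    using r_coset_hom_Mod by unfold_locales
  have iff: "x \<in> centre_preimage G Z \<longleftrightarrow>
      x \<in> carrier G \<and> (\<forall>q\<in>carrier ?Q. ?p x \<otimes>\<^bsub>?Q\<^esub> q = q \<otimes>\<^bsub>?Q\<^esub> ?p x)" for x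
    unfolding centre_preimage_def group_centre_def using h.hom_closed by blast
  have sub: "subgroup (centre_preimage G Z) G"
  proof (rule subgroupI)
    show "centre_preimage G Z \<subseteq> carrier G" using iff by blast
    have "\<one>\<^bsub>G\<^esub> \<in> centre_preimage G Z"
      unfolding iff using h.hom_one Q.l_one Q.r_one by simp
    then show "centre_preimage G Z \<noteq> {}" by blast
  next
    fix a assume "a \<in> centre_preimage G Z"
    then show "inv\<^bsub>G\<^esub> a \<in> centre_preimage G Z"
      unfolding iff using Q.commute_inv h.hom_inv h.hom_closed by simp
  next
    fix a b assume ab: "a \<in> centre_preimage G Z" "b \<in> centre_preimage G Z"
    show "a \<otimes>\<^bsub>G\<^esub> b \<in> centre_preimage G Z"
      unfolding iff
    proof (intro conjI ballI)
      show "a \<otimes>\<^bsub>G\<^esub> b \<in> carrier G" using ab iff by blast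
    next
      fix q assume q: "q \<in> carrier ?Q"
      have c: "?p a \<in> carrier ?Q" "?p b \<in> carrier ?Q"
        using ab iff h.hom_closed by blast+
      have "?p (a \<otimes>\<^bsub>G\<^esub> b) = ?p a \<otimes>\<^bsub>?Q\<^esub> ?p b" using ab iff h.hom_mult by blast
      moreover have "?p a \<otimes>\<^bsub>?Q\<^esub> ?p b \<otimes>\<^bsub>?Q\<^esub> q = ?p a \<otimes>\<^bsub>?Q\<^esub> (q \<otimes>\<^bsub>?Q\<^esub> ?p b)"
        using ab q c Q.m_assoc iff by metis
      moreover have "\<dots> = q \<otimes>\<^bsub>?Q\<^esub> ?p a \<otimes>\<^bsub>?Q\<^esub> ?p b"
        using ab q c Q.m_assoc iff by metis
      moreover have "\<dots> = q \<otimes>\<^bsub>?Q\<^esub> (?p a \<otimes>\<^bsub>?Q\<^esub> ?p b)"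
        using q c Q.m_assoc by metis
      ultimately show "?p (a \<otimes>\<^bsub>G\<^esub> b) \<otimes>\<^bsub>?Q\<^esub> q = q \<otimes>\<^bsub>?Q\<^esub> ?p (a \<otimes>\<^bsub>G\<^esub> b)"
        by simp
    qed
  qed
  show "centre_preimage G Z \<lhd> G"
    unfolding normal_inv_iff
  proof (intro conjI sub ballI)
    fix x a assume x: "x \<in> carrier G" and a: "a \<in> centre_preimage G Z"
    have aG: "a \<in> carrier G" using a iff by blast
    have c: "?p x \<in> carrier ?Q" "?p a \<in> carrier ?Q"
      using x aG h.hom_closed by blast+
    have "?p (x \<otimes>\<^bsub>G\<^esub> a \<otimes>\<^bsub>G\<^esub> inv\<^bsub>G\<^esub> x) = ?p x \<otimes>\<^bsub>?Q\<^esub> ?p a \<otimes>\<^bsub>?Q\<^esub> inv\<^bsub>?Q\<^esub> ?p x"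
      using x aG h.hom_mult h.hom_inv by simp
    also have "\<dots> = ?p a \<otimes>\<^bsub>?Q\<^esub> ?p x \<otimes>\<^bsub>?Q\<^esub> inv\<^bsub>?Q\<^esub> ?p x"
      using a iff c by metis
    also have "\<dots> = ?p a"
      using c Q.m_assoc Q.r_inv Q.r_one Q.inv_closed by metis
    finally have "?p (x \<otimes>\<^bsub>G\<^esub> a \<otimes>\<^bsub>G\<^esub> inv\<^bsub>G\<^esub> x) = ?p a" .
    moreover have "x \<otimes>\<^bsub>G\<^esub> a \<otimes>\<^bsub>G\<^esub> inv\<^bsub>G\<^esub> x \<in> carrier G" using x aG by simp
    ultimately show "x \<otimes>\<^bsub>G\<^esub> a \<otimes>\<^bsub>G\<^esub> inv\<^bsub>G\<^esub> x \<in> centre_preimage G Z"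
      using a iff by metis
  qed
  show "Z \<subseteq> centre_preimage G Z"
  proof
    fix x assume x: "x \<in> Z"
    then have "?p x = \<one>\<^bsub>?Q\<^esub>"
      by (simp add: FactGroup_def coset_join2 subgroup_axioms)
    with x show "x \<in> centre_preimage G Z"
      unfolding iff using Q.l_one Q.r_one by (metis mem_carrier)
  qed
qed

text \<open>The series is an ascending chain of normal subgroups.\<close>

lemma (in group) upper_central_normal_mono:
  "upper_central G i \<lhd> G \<and> (\<forall>j\<in>underS (ordinals_for G) i. upper_central G j \<subseteq> upper_central G i)"
proof -
  interpret W: wo_rel "ordinals_for G" by (rule wo_rel_ordinals_for)
  let ?r = "ordinals_for G" and ?U = "upper_central G"
  show ?thesis
  proof (induction i rule: W.well_order_induct)
    case (1 i)
    then have IH: "?U j \<lhd> G" "\<And>k. k \<in> underS ?r j \<Longrightarrow> ?U k \<subseteq> ?U j" if "j \<in> underS ?r i" for j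
      using that by (auto simp: underS_def)
    consider "underS ?r i = {}"
      | j where "underS ?r i = under ?r j" "underS ?r i \<noteq> {}"
      | "underS ?r i \<noteq> {}" "\<nexists>j. underS ?r i = under ?r j"
      by blast
    then show ?case
    proof cases
      case 1
      then show ?thesis using upper_central_zero[OF 1] one_is_normal by simp
    next
      case (2 j)
      have j: "j \<in> underS ?r i" using W.successor_below 2 by blast
      then have jF: "j \<in> Field ?r" by (auto simp: underS_def Field_def)
      have eq: "?U i = centre_preimage G (?U j)"
        by (rule upper_central_successor[OF 2(1) jF])
      have "?U k \<subseteq> ?U i" if "k \<in> underS ?r i" for k
      proof -
        have "k = j \<or> k \<in> underS ?r j"
          using that 2(1) by (auto simp: underS_def under_def)
        then have "?U k \<subseteq> ?U j" using IH(2)[OF j] by blast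
        then show ?thesis using centre_preimage_normal(2)[OF IH(1)[OF j]] eq by blast
      qed
      then show ?thesis using centre_preimage_normal(1)[OF IH(1)[OF j]] eq by simp
    next
      case 3
      have eq: "?U i = (\<Union>j\<in>underS ?r i. ?U j)" by (rule upper_central_limit[OF 3])
      have mem: "a \<in> ?U i" if "j \<in> underS ?r i" "a \<in> ?U j" for a j
        unfolding eq using that by (rule UN_I)
      have sub: "subgroup (?U j) G" if "j \<in> underS ?r i" for j
        using IH(1)[OF that] by (rule normal_imp_subgroup)
      have chain: "?U j \<subseteq> ?U k \<or> ?U k \<subseteq> ?U j"
        if jk: "j \<in> underS ?r i" "k \<in> underS ?r i" for j k
      proof -
        have "j \<in> Field ?r" "k \<in> Field ?r"
          using jk by (auto simp: underS_def Field_def)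
        then have "j = k \<or> j \<in> underS ?r k \<or> k \<in> underS ?r j"
          using W.TOTALS by (auto simp: underS_def)
        then show ?thesis using IH(2) jk by blast
      qed
      have "subgroup (?U i) G"
      proof (rule subgroupI)
        show "?U i \<subseteq> carrier G"
          unfolding eq using subgroup.subset[OF sub] by (rule UN_least)
        obtain j where j: "j \<in> underS ?r i" using 3(1) by blast
        show "?U i \<noteq> {}"
          using subgroup.one_closed[OF sub[OF j]] mem[OF j] by (metis empty_iff)
      next
        fix a assume "a \<in> ?U i"
        then obtain j where j: "j \<in> underS ?r i" "a \<in> ?U j" unfolding eq by (rule UN_E)
        show "inv a \<in> ?U i"
          by (rule mem[OF j(1) subgroup.m_inv_closed[OF sub[OF j(1)] j(2)]])
      next
        fix a b assume a: "a \<in> ?U i" and b: "b \<in> ?U i"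
        obtain j where j: "j \<in> underS ?r i" "a \<in> ?U j" using a unfolding eq by (rule UN_E)
        obtain k where k: "k \<in> underS ?r i" "b \<in> ?U k" using b unfolding eq by (rule UN_E)
        obtain l where l: "l \<in> underS ?r i" "a \<in> ?U l" "b \<in> ?U l"
          using chain[OF j(1) k(1)] j k by (meson subsetD)
        show "a \<otimes> b \<in> ?U i"
          by (rule mem[OF l(1) subgroup.m_closed[OF sub[OF l(1)] l(2,3)]])
      qed
      moreover have "x \<otimes> a \<otimes> inv x \<in> ?U i" if x: "x \<in> carrier G" and a: "a \<in> ?U i" for x a
      proof -
        obtain j where j: "j \<in> underS ?r i" "a \<in> ?U j" using a unfolding eq by (rule UN_E)
        show ?thesis
          by (rule mem[OF j(1) normal.inv_op_closed2[OF IH(1)[OF j(1)] x j(2)]])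
      qed
      ultimately have "?U i \<lhd> G" by (simp add: normal_inv_iff)
      moreover have "\<forall>j\<in>underS ?r i. ?U j \<subseteq> ?U i" using mem by (intro ballI subsetI)
      ultimately show ?thesis by (rule conjI)
    qed
  qed
qed

lemma (in group) upper_central_stabilises:
  "\<exists>\<alpha>\<in>Field (ordinals_for G). \<forall>\<beta>\<in>Field (ordinals_for G).
     (\<alpha>, \<beta>) \<in> ordinals_for G \<longrightarrow> upper_central G \<beta> = upper_central G \<alpha>"
proof (rule ccontr)
  interpret W: wo_rel "ordinals_for G" by (rule wo_rel_ordinals_for)
  let ?r = "ordinals_for G" and ?U = "upper_central G"
  assume contr: "\<not> ?thesis"
  have mono: "?U a \<subseteq> ?U b" if "(a, b) \<in> ?r" for a b
    using that upper_central_normal_mono[of b] by (cases "a = b") (auto simp: underS_def)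
  have step: "\<exists>x. x \<in> carrier G \<and> x \<notin> ?U a \<and> (\<forall>b. (a, b) \<in> ?r \<and> a \<noteq> b \<longrightarrow> x \<in> ?U b)"
    if a: "a \<in> Field ?r" for a
  proof -
    have ne: "aboveS ?r a \<noteq> {}"
      using contr a by (auto simp: aboveS_def)
    have AF: "aboveS ?r a \<subseteq> Field ?r" by (auto simp: aboveS_def Field_def)
    define s where "s = W.minim (aboveS ?r a)"
    have s: "s \<in> aboveS ?r a" "\<And>b. b \<in> aboveS ?r a \<Longrightarrow> (s, b) \<in> ?r"
      unfolding s_def using W.minim_in[OF AF ne] W.minim_least[OF AF] by blast+
    have under_s: "underS ?r s = under ?r a"
    proof (intro equalityI subsetI)
      fix b assume b: "b \<in> underS ?r s"
      then have "b \<in> Field ?r" by (auto simp: underS_def Field_def)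
      then have total: "(b, a) \<in> ?r \<or> (a, b) \<in> ?r" "(a, a) \<in> ?r"
        using W.TOTALS a by blast+
      have "b \<notin> aboveS ?r a"
        using s(2)[of b] b antisymD[OF W.ANTISYM, of s b] by (auto simp: underS_def)
      then show "b \<in> under ?r a"
        using total by (cases "a = b") (auto simp: aboveS_def under_def)
    next
      fix b assume "b \<in> under ?r a"
      then have b: "(b, a) \<in> ?r" by (simp add: under_def)
      have as: "(a, s) \<in> ?r" "a \<noteq> s" using s(1) by (auto simp: aboveS_def)
      have "(b, s) \<in> ?r" by (rule transD[OF W.TRANS b as(1)])
      moreover have "b \<noteq> s" using b as antisymD[OF W.ANTISYM] by blast
      ultimately show "b \<in> underS ?r s" by (simp add: underS_def)
    qed
    have Us: "?U s = centre_preimage G (?U a)"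
      by (rule upper_central_successor[OF under_s a])
    have "?U s \<noteq> ?U a"
    proof
      assume fix_eq: "?U s = ?U a"
      have "(a, b) \<in> ?r \<longrightarrow> ?U b = ?U a" for b
      proof (induction b rule: W.well_order_induct)
        case (1 b)
        show ?case
        proof
          assume ab: "(a, b) \<in> ?r"
          have below: "?U c \<subseteq> ?U a" if "c \<in> underS ?r b" for c
          proof -
            have "c \<in> Field ?r" using that by (auto simp: underS_def Field_def)
            then have "(c, a) \<in> ?r \<or> (a, c) \<in> ?r" using W.TOTALS a by blast
            then show ?thesis using 1 that mono by (auto simp: underS_def)
          qed
          show "?U b = ?U a"
          proof (cases "a = b")
            case False
            then have ab': "a \<in> underS ?r b" using ab by (auto simp: underS_def)
            have "?U b \<subseteq> ?U a"
            proof (cases "\<exists>j. underS ?r b = under ?r j")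
              case True
              then obtain j where j: "underS ?r b = under ?r j" by blast
              have jb: "j \<in> underS ?r b" using W.successor_below[OF j] ab' by blast
              then have jF: "j \<in> Field ?r" by (auto simp: underS_def Field_def)
              have "(a, j) \<in> ?r" using ab' j by (auto simp: under_def)
              then have "?U j = ?U a" using 1 jb by (auto simp: underS_def)
              then show ?thesis using upper_central_successor[OF j jF] Us fix_eq by simp
            next
              case no: False
              show ?thesis using upper_central_limit[of G b] ab' no below by blast
            qed
            then show ?thesis using mono[OF ab] by blast
          qed simp
        qed
      qed
      then show False using contr a by blast
    qed
    moreover have "?U a \<subseteq> ?U s" using s(1) mono by (auto simp: aboveS_def)
    ultimately obtain x where x: "x \<in> ?U s" "x \<notin> ?U a" by blast
    moreover have "x \<in> carrier G"
      using x(1) upper_central_normal_mono[of s] normal_imp_subgroup subgroup.subset by blast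
    moreover have "x \<in> ?U b" if "(a, b) \<in> ?r" "a \<noteq> b" for b
      using s(2)[of b] that mono x(1) by (auto simp: aboveS_def)
    ultimately show ?thesis by blast
  qed
  then obtain f where f: "\<And>a. a \<in> Field ?r \<Longrightarrow> f a \<in> carrier G \<and> f a \<notin> ?U a \<and>
      (\<forall>b. (a, b) \<in> ?r \<and> a \<noteq> b \<longrightarrow> f a \<in> ?U b)"
    by metis
  have "inj_on f (Field ?r)"
  proof (rule inj_onI, rule ccontr)
    fix a b assume "a \<in> Field ?r" "b \<in> Field ?r" "f a = f b" "a \<noteq> b"
    then show False using f W.TOTALS by metis
  qed
  moreover have "f ` Field ?r \<subseteq> carrier G" using f by blast
  ultimately have "|Field ?r| \<le>o |carrier G|"
    using card_of_ordLeq by blast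
  moreover have "|Field ?r| =o ?r"
    by (rule card_of_Field_ordIso[OF Card_order_ordinals_for])
  ultimately show False
    using ordinals_for_greater[of G] not_ordLess_ordLeq ordIso_ordLeq_trans ordIso_symmetric
    by blast
qed

lemma (in group) hypercentre_eq_Union:
  "hypercentre G = (\<Union>\<beta>\<in>Field (ordinals_for G). upper_central G \<beta>)"
proof -
  interpret W: wo_rel "ordinals_for G" by (rule wo_rel_ordinals_for)
  let ?r = "ordinals_for G" and ?U = "upper_central G"
  have mono: "?U a \<subseteq> ?U b" if "(a, b) \<in> ?r" for a b
    using that upper_central_normal_mono[of b] by (cases "a = b") (auto simp: underS_def)
  obtain \<alpha> where \<alpha>: "\<alpha> \<in> Field ?r"
      "\<And>\<beta>. \<beta> \<in> Field ?r \<Longrightarrow> (\<alpha>, \<beta>) \<in> ?r \<Longrightarrow> ?U \<beta> = ?U \<alpha>"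
    using upper_central_stabilises by blast
  have "hypercentre G = ?U \<alpha>"
    unfolding hypercentre_def
  proof (rule the_equality)
    show "\<exists>a\<in>Field ?r. \<forall>\<beta>\<in>Field ?r. (a, \<beta>) \<in> ?r \<longrightarrow> ?U \<beta> = ?U \<alpha>"
      using \<alpha> by blast
  next
    fix H assume "\<exists>a\<in>Field ?r. \<forall>\<beta>\<in>Field ?r. (a, \<beta>) \<in> ?r \<longrightarrow> ?U \<beta> = H"
    then obtain a where a: "a \<in> Field ?r" "\<And>\<beta>. \<beta> \<in> Field ?r \<Longrightarrow> (a, \<beta>) \<in> ?r \<Longrightarrow> ?U \<beta> = H"
      by blast
    have "(a, a) \<in> ?r" "(\<alpha>, \<alpha>) \<in> ?r"
      using a(1) \<alpha>(1) W.TOTALS by blast+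
    then show "H = ?U \<alpha>" using W.TOTALS a \<alpha> by metis
  qed
  moreover have "?U \<beta> \<subseteq> ?U \<alpha>" if "\<beta> \<in> Field ?r" for \<beta>
    using W.TOTALS that \<alpha> mono by blast
  ultimately show ?thesis using \<alpha>(1) by blast
qed

end

theory Submission
  imports Defs
begin

text \<open>The functions on \<open>\<Gamma>\<close> that come from \<open>\<Gamma>/N\<close> are those invariant under left translation by \<open>N\<close>, and
for them harmonicity with respect to \<open>\<mu>\<close> and to its push-forward is the same equation. So it suffices
that every bounded \<open>\<mu>\<close>-harmonic function on \<open>\<Gamma>\<close> is \<open>N\<close>-invariant. Then \<open>\<Gamma>\<close> is Liouville exactly
when \<open>\<Gamma>/N\<close> is Liouville for the push-forward (\<open>liouville_pushforward_iff\<close>). A lazy version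
\<open>t \<delta> + (1 - t) \<nu>\<close> with \<open>t < 1\<close> has the same harmonic functions as \<open>\<nu>\<close>
(\<open>lazy_version_liouville_iff\<close>).

Let \<open>K\<close> be the set of \<open>z\<close> with \<open>f (z g) = f g\<close> for all \<open>g\<close> and all bounded harmonic \<open>f\<close>. The inclusion of \<open>N\<close>
in \<open>K\<close> (\<open>hypercentral_subgroup_subset_harmonic_periods\<close>) rests on three observations.

\<^item> A property of group elements that passes from all the commutators \<open>[z, g] = z g z\<inverse> g\<inverse>\<close> to \<open>z\<close> itself,
  and holds at the identity, holds on the hypercentre (\<open>hypercentre_induct\<close>). Commutators of an element of
  \<open>Z\<^sup>\<lambda>\<^sup>+\<^sup>1\<close> lie in \<open>Z\<^sup>\<lambda>\<close>, so this is transfinite induction along the upper central series.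

\<^item> A submonoid \<open>S\<close> of a subgroup of the hypercentre satisfies the Ore condition: \<open>x S\<close> meets \<open>y S\<close> for
  all \<open>x\<close>, \<open>y\<close> in \<open>S\<close>. Indeed, if \<open>x = z y\<close> then \<open>x y = [z, y] (y x)\<close>, so replacing \<open>(x, y)\<close> by \<open>(x y, y x)\<close>
  moves the quotient down the series. Hence the group generated by \<open>S\<close> consists of the quotients
  \<open>a b\<inverse>\<close> with \<open>a\<close>, \<open>b\<close> in \<open>S\<close> (\<open>generate_eq_quotients\<close>). With \<open>S\<close> generated by the part
  of the support of \<open>\<mu>\<close> in \<open>N\<close>, every element of \<open>N\<close> is such a quotient.

\<^item> If \<open>z = a b\<inverse>\<close> with \<open>a\<close>, \<open>b\<close> products of elements of the support of \<open>\<mu>\<close>, and \<open>z\<close> is central modulo \<open>K\<close>,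
  then \<open>z\<close> lies in \<open>K\<close> (\<open>quotient_mem_harmonic_periods\<close>). This is a Choquet-Deny argument: the
  harmonic function \<open>D g = f (z g) - f g\<close> has a supremum \<open>s\<close>, and a point where \<open>D\<close> is almost \<open>s\<close> propagates to
  its translates by \<open>(a\<^sup>i b\<^sup>n\<^sup>-\<^sup>i)\<inverse>\<close>. Those translates differ by powers of \<open>z\<close> modulo \<open>K\<close>, so
  the values of \<open>D\<close> there telescope to a difference of two values of \<open>f\<close>. If \<open>s\<close> were
  positive, this difference would grow linearly in \<open>n\<close>, although \<open>f\<close> is bounded.

By commutator induction on \<open>z \<in> N\<close>, all \<open>[z, g]\<close> lie in \<open>N\<close>, hence in \<open>K\<close>; the second and third
observations then put \<open>z\<close> in \<open>K\<close>.\<close>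

lemma (in group) mult_inv_cancel_left:
  assumes "a \<in> carrier G" "b \<in> carrier G"
  shows "inv a \<otimes> (a \<otimes> b) = b" "a \<otimes> (inv a \<otimes> b) = b"
  using assms by (simp_all flip: m_assoc)

section \<open>Commutator descent in the hypercentre\<close>

lemma (in group) commutator_mem_if_centre_preimage:
  assumes "Z \<lhd> G" "z \<in> centre_preimage G Z" "g \<in> carrier G"
  shows "z \<otimes> g \<otimes> inv z \<otimes> inv g \<in> Z"
proof -
  interpret Z: normal Z G by (rule assms)
  have z: "z \<in> carrier G" and "Z #> z \<in> group_centre (G Mod Z)"
    using assms(2) by (auto simp: centre_preimage_def)
  moreover have "Z #> g \<in> carrier (G Mod Z)"
    using assms(3) by (simp add: FactGroup_def rcosetsI Z.subset)
  ultimately have "(Z #> z) <#> (Z #> g) = (Z #> g) <#> (Z #> z)"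
    by (simp add: group_centre_def)
  then have "Z #> (z \<otimes> g) = Z #> (g \<otimes> z)"
    using z assms(3) by (simp add: Z.rcos_sum)
  then have "z \<otimes> g \<in> Z #> (g \<otimes> z)"
    using z assms(3) by (metis rcos_self m_closed Z.is_subgroup)
  then obtain h where h: "h \<in> Z" "z \<otimes> g = h \<otimes> (g \<otimes> z)"
    by (auto simp: r_coset_def)
  then have hG: "h \<in> carrier G" using Z.mem_carrier by blast
  have "z \<otimes> g \<otimes> inv z \<otimes> inv g = (z \<otimes> g) \<otimes> inv (g \<otimes> z)"
    using z assms(3) by (simp add: m_assoc inv_mult_group)
  also have "\<dots> = h"
    unfolding h(2) using hG z assms(3) by (simp add: m_assoc inv_mult_group mult_inv_cancel_left)
  finally show ?thesis using h(1) by simp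
qed

text \<open>Transfinite induction along the upper central series, with the ordinals removed: each successor
step is the commutator rule, because commutators of an element of one term lie in the
preceding term.\<close>

lemma (in group) hypercentre_induct [consumes 1, case_names one commutator]:
  assumes "z \<in> hypercentre G"
    and one: "P \<one>"
    and comm: "\<And>z. z \<in> carrier G \<Longrightarrow> (\<And>g. g \<in> carrier G \<Longrightarrow> P (z \<otimes> g \<otimes> inv z \<otimes> inv g)) \<Longrightarrow> P z"
  shows "P z"
proof -
  let ?r = "ordinals_for G" and ?U = "upper_central G"
  interpret W: wo_rel ?r by (rule wo_rel_ordinals_for)
  have "\<forall>z\<in>?U i. P z" for i
  proof (induction i rule: W.well_order_induct)
    case (1 i)
    consider "underS ?r i = {}"
      | j where "underS ?r i = under ?r j" "underS ?r i \<noteq> {}"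
      | "underS ?r i \<noteq> {}" "\<nexists>j. underS ?r i = under ?r j"
      by blast
    then show ?case
    proof cases
      case 1
      then show ?thesis using upper_central_zero[OF 1] one by simp
    next
      case (2 j)
      have j: "j \<in> underS ?r i" using W.successor_below 2 by blast
      then have jF: "j \<in> Field ?r" by (auto simp: underS_def Field_def)
      have IH: "\<forall>z\<in>?U j. P z" using 1 j by (auto simp: underS_def)
      have norm: "?U j \<lhd> G" using upper_central_normal_mono by blast
      show ?thesis
        unfolding upper_central_successor[OF 2(1) jF]
      proof
        fix z assume z: "z \<in> centre_preimage G (?U j)"
        then show "P z"
          using IH commutator_mem_if_centre_preimage[OF norm z]
          by - (rule comm, auto simp: centre_preimage_def)
      qed
    next
      case 3
      then show ?thesis
        using 1 unfolding upper_central_limit[OF 3] by (auto simp: underS_def)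
    qed
  qed
  then show ?thesis using assms(1) unfolding hypercentre_eq_Union by blast
qed

section \<open>Submonoids of the hypercentre\<close>

text \<open>From \<open>x = z y\<close> follows \<open>x y = [z, y] (y x)\<close>, so the claim for the pair \<open>(x, y)\<close> reduces to
the claim for \<open>(x y, y x)\<close>, whose quotient is a commutator of \<open>z\<close>. A solution \<open>x y u = y x v\<close> for that pair
gives the solution \<open>x (y u) = y (x v)\<close> for the original one.\<close>

lemma (in group) hypercentre_right_Ore:
  assumes S: "submonoid S G" and "x \<in> S" "y \<in> S" and "x \<otimes> inv y \<in> hypercentre G"
  shows "\<exists>u\<in>S. \<exists>v\<in>S. x \<otimes> u = y \<otimes> v"
proof -
  interpret S: submonoid S G by (rule S)
  have "\<forall>x\<in>S. \<forall>y\<in>S. x = z \<otimes> y \<longrightarrow> (\<exists>u\<in>S. \<exists>v\<in>S. x \<otimes> u = y \<otimes> v)"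
    if "z \<in> hypercentre G" for z
    using that
  proof (induction z rule: hypercentre_induct)
    case one
    then show ?case by auto
  next
    case (commutator z)
    show ?case
    proof (intro ballI impI)
      fix x y assume xy: "x \<in> S" "y \<in> S" "x = z \<otimes> y"
      have y: "y \<in> carrier G" using xy by simp
      have "x \<otimes> y = (z \<otimes> y \<otimes> inv z \<otimes> inv y) \<otimes> (y \<otimes> x)"
        using y commutator(1) xy(3) by (simp add: m_assoc mult_inv_cancel_left)
      then obtain u v where uv: "u \<in> S" "v \<in> S" "(x \<otimes> y) \<otimes> u = (y \<otimes> x) \<otimes> v"
        using commutator(2)[OF y, rule_format, OF S.m_closed[OF xy(1,2)] S.m_closed[OF xy(2,1)]]
        by metis
      then have "x \<otimes> (y \<otimes> u) = y \<otimes> (x \<otimes> v)"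
        using xy(1,2) by (simp add: m_assoc)
      then show "\<exists>u\<in>S. \<exists>v\<in>S. x \<otimes> u = y \<otimes> v"
        using S.m_closed[OF xy(2) uv(1)] S.m_closed[OF xy(1) uv(2)] by metis
    qed
  qed
  moreover have "x = (x \<otimes> inv y) \<otimes> y" using assms(2,3) by (simp add: m_assoc)
  ultimately show ?thesis using assms(2-4) by metis
qed

text \<open>The Ore condition rewrites the inner factor \<open>b\<inverse> c\<close> of a product \<open>a b\<inverse> c d\<inverse>\<close> of two quotients as
\<open>u v\<inverse>\<close>, so the product is again a quotient.\<close>

lemma (in group) generate_eq_quotients:
  assumes N: "subgroup N G" "N \<subseteq> hypercentre G" and S: "submonoid S G" "S \<subseteq> N"
    and z: "z \<in> generate G S"
  shows "\<exists>a\<in>S. \<exists>b\<in>S. z = a \<otimes> inv b"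
proof -
  interpret N: subgroup N G by (rule N)
  interpret S: submonoid S G by (rule S)
  show ?thesis using z
  proof (induction z rule: generate.induct)
    case one
    show ?case using S.one_closed by (metis inv_one r_one one_closed)
  next
    case (incl h)
    then show ?case using S.one_closed by (metis inv_one r_one S.mem_carrier)
  next
    case (inv h)
    then show ?case using S.one_closed by (metis l_one S.mem_carrier inv_closed)
  next
    case (eng h1 h2)
    then obtain a b c d where abcd: "a \<in> S" "b \<in> S" "c \<in> S" "d \<in> S"
      and h: "h1 = a \<otimes> inv b" "h2 = c \<otimes> inv d" by metis
    have "b \<otimes> inv c \<in> hypercentre G" 
      by (intro subsetD[OF N(2)] N.m_closed N.m_inv_closed subsetD[OF S(2)] abcd)
    then obtain u v where uv: "u \<in> S" "v \<in> S" "b \<otimes> u = c \<otimes> v"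
      using hypercentre_right_Ore[OF S(1)] abcd by metis
    have carr: "a \<in> carrier G" "b \<in> carrier G" "c \<in> carrier G" "d \<in> carrier G"
      "u \<in> carrier G" "v \<in> carrier G"
      using abcd uv by auto
    have "inv b \<otimes> c = u \<otimes> inv v"
    proof -
      have "inv b \<otimes> c = inv b \<otimes> (c \<otimes> v) \<otimes> inv v"
        using carr by (simp add: m_assoc)
      also have "\<dots> = u \<otimes> inv v"
        unfolding uv(3)[symmetric] using carr by (simp add: mult_inv_cancel_left)
      finally show ?thesis .
    qed
    then have "h1 \<otimes> h2 = a \<otimes> (u \<otimes> inv v) \<otimes> inv d"
      unfolding h using carr by (metis m_assoc m_closed inv_closed)
    also have "\<dots> = (a \<otimes> u) \<otimes> inv (d \<otimes> v)"
      using carr by (simp add: inv_mult_group m_assoc)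
    finally show ?case
      using S.m_closed[OF abcd(1) uv(1)] S.m_closed[OF abcd(4) uv(2)] by metis
  qed
qed

text \<open>The analogue of \<open>generate\<close> without inverses: a random walk reaches products of steps, but not
their inverses, and the maximum principle below only follows the walk.\<close>

inductive_set submonoid_span :: "('a, 'b) monoid_scheme \<Rightarrow> 'a set \<Rightarrow> 'a set"
  for G (structure) and A where
  one: "\<one> \<in> submonoid_span G A"
| incl: "a \<in> A \<Longrightarrow> a \<in> submonoid_span G A"
| mult: "x \<in> submonoid_span G A \<Longrightarrow> y \<in> submonoid_span G A \<Longrightarrow> x \<otimes> y \<in> submonoid_span G A"

lemma (in monoid) submonoid_span_least:
  assumes "submonoid H G" "A \<subseteq> H"
  shows "submonoid_span G A \<subseteq> H"
proof
  interpret submonoid H G by (rule assms)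
  fix x assume "x \<in> submonoid_span G A"
  then show "x \<in> H" by induction (use assms(2) in auto)
qed

lemma (in monoid) submonoid_span_submonoid:
  assumes "A \<subseteq> carrier G"
  shows "submonoid (submonoid_span G A) G"
proof
  show "submonoid_span G A \<subseteq> carrier G"
    using submonoid_span_least[OF _ assms] by (simp add: submonoid_def)
qed (auto intro: submonoid_span.intros)

section \<open>Bounded harmonic functions and expectations\<close>

lemma bounded_integrable_measure_pmf:
  fixes h :: "'a \<Rightarrow> real"
  assumes "bounded (h ` A)" "set_pmf P \<subseteq> A"
  shows "integrable (measure_pmf P) h"
proof -
  obtain B where B: "\<And>x. x \<in> A \<Longrightarrow> norm (h x) \<le> B"
    using assms(1) by (auto simp: bounded_iff)
  show ?thesis
    by (rule measure_pmf.integrable_const_bound[where B = B])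
      (use B assms(2) in \<open>auto simp: AE_measure_pmf_iff\<close>)
qed

text \<open>This turns the sums over the carrier by which convolution is defined into expectations, for which
linearity, monotonicity and push-forward are at hand.\<close>

lemma bounded_pmf_has_sum:
  fixes h :: "'a \<Rightarrow> real"
  assumes "bounded (h ` A)" "set_pmf P \<subseteq> A"
  shows "((\<lambda>y. h y * pmf P y) has_sum measure_pmf.expectation P h) A"
proof -
  have int: "integrable (measure_pmf P) h"
    by (rule bounded_integrable_measure_pmf[OF assms])
  have "((\<lambda>y. h y * pmf P y) has_sum measure_pmf.expectation P h) UNIV"
  proof -
    let ?k = "\<lambda>y. pmf P y * h y"
    have "integrable (count_space UNIV) ?k"
      using int unfolding measure_pmf_eq_density by (subst (asm) integrable_density) simp_all
    then have abs: "Infinite_Set_Sum.abs_summable_on ?k UNIV"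
      by (simp add: Infinite_Set_Sum.abs_summable_on_def)
    moreover have "infsetsum ?k UNIV = measure_pmf.expectation P h"
      unfolding infsetsum_def measure_pmf_eq_density by (subst integral_density) simp_all
    ultimately have "infsum ?k UNIV = measure_pmf.expectation P h"
      by (simp add: infsetsum_infsum)
    moreover have "?k summable_on UNIV"
      using abs abs_summable_equivalent abs_summable_summable by blast
    ultimately show ?thesis by (simp add: has_sum_iff mult.commute)
  qed
  then show ?thesis
    by (rule has_sum_cong_neutral[THEN iffD1, rotated -1])
      (use assms(2) in \<open>auto simp: set_pmf_iff\<close>)
qed

context group
begin

lemma bounded_translate:
  assumes "bounded (f ` carrier G)" "g \<in> carrier G"
  shows "bounded ((\<lambda>y. f (g \<otimes> inv y)) ` carrier G)"
  by (rule bounded_subset[OF assms(1)]) (use assms(2) in auto)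

lemma conv_fun_eq_expectation:
  assumes "bounded (f ` carrier G)" "prob_measure_on G P" "g \<in> carrier G"
  shows "conv_fun G f P g = measure_pmf.expectation P (\<lambda>y. f (g \<otimes> inv y))"
  unfolding conv_fun_def
  by (rule infsumI bounded_pmf_has_sum bounded_translate)+
    (use assms in \<open>auto simp: prob_measure_on_def\<close>)

definition bounded_harmonic :: "'a pmf \<Rightarrow> ('a \<Rightarrow> real) set" where
  "bounded_harmonic P = {f. bounded (f ` carrier G) \<and> harmonic G P f}"

lemma bounded_harmonicD:
  assumes "prob_measure_on G P" "f \<in> bounded_harmonic P" "g \<in> carrier G"
  shows "integrable (measure_pmf P) (\<lambda>y. f (g \<otimes> inv y))"
    and "measure_pmf.expectation P (\<lambda>y. f (g \<otimes> inv y)) = f g"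
proof -
  show "integrable (measure_pmf P) (\<lambda>y. f (g \<otimes> inv y))"
    using assms
    by (intro bounded_integrable_measure_pmf[OF bounded_translate])
      (auto simp: bounded_harmonic_def prob_measure_on_def)
  show "measure_pmf.expectation P (\<lambda>y. f (g \<otimes> inv y)) = f g"
    using assms conv_fun_eq_expectation
    by (auto simp: bounded_harmonic_def harmonic_def)
qed

lemma bounded_harmonicI:
  assumes "prob_measure_on G P" "bounded (f ` carrier G)"
    and "\<And>g. g \<in> carrier G \<Longrightarrow> measure_pmf.expectation P (\<lambda>y. f (g \<otimes> inv y)) = f g"
  shows "f \<in> bounded_harmonic P"
  using assms conv_fun_eq_expectation by (auto simp: bounded_harmonic_def harmonic_def)

lemma bounded_harmonic_left_translate:
  assumes P: "prob_measure_on G P" and f: "f \<in> bounded_harmonic P" and x: "x \<in> carrier G"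
  shows "(\<lambda>g. f (x \<otimes> g)) \<in> bounded_harmonic P"
proof (rule bounded_harmonicI[OF P])
  have "bounded (f ` carrier G)" using f by (simp add: bounded_harmonic_def)
  then show "bounded ((\<lambda>g. f (x \<otimes> g)) ` carrier G)"
    by (rule bounded_subset) (use x in auto)
next
  fix g assume g: "g \<in> carrier G"
  have "measure_pmf.expectation P (\<lambda>y. f (x \<otimes> (g \<otimes> inv y)))
      = measure_pmf.expectation P (\<lambda>y. f ((x \<otimes> g) \<otimes> inv y))"
    by (rule integral_cong_AE)
      (use P x g in \<open>auto simp: AE_measure_pmf_iff prob_measure_on_def m_assoc\<close>)
  then show "measure_pmf.expectation P (\<lambda>y. f (x \<otimes> (g \<otimes> inv y))) = f (x \<otimes> g)"
    using bounded_harmonicD(2)[OF P f, of "x \<otimes> g"] x g by simp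
qed

lemma bounded_harmonic_diff:
  assumes P: "prob_measure_on G P" and f: "f \<in> bounded_harmonic P" and h: "h \<in> bounded_harmonic P"
  shows "(\<lambda>g. f g - h g) \<in> bounded_harmonic P"
proof (rule bounded_harmonicI[OF P])
  have "bounded (f ` carrier G)" "bounded (h ` carrier G)"
    using f h by (auto simp: bounded_harmonic_def)
  then show "bounded ((\<lambda>g. f g - h g) ` carrier G)"
    by (rule bounded_minus_comp)
qed (use bounded_harmonicD[OF P f] bounded_harmonicD[OF P h] in simp)

section \<open>The maximum principle and periods of harmonic functions\<close>

text \<open>The nonnegative function \<open>s - D\<close> is harmonic too, and its average over one step is at least the
contribution of the single step \<open>y\<close>.\<close>

lemma near_maximum_step:
  assumes P: "prob_measure_on G P" and D: "D \<in> bounded_harmonic P"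
    and le: "\<And>x. x \<in> carrier G \<Longrightarrow> D x \<le> s"
    and g: "g \<in> carrier G" and y: "y \<in> set_pmf P"
  shows "s - D (g \<otimes> inv y) \<le> (s - D g) / pmf P y"
proof -
  let ?h = "\<lambda>x. s - D (g \<otimes> inv x)"
  have yG: "set_pmf P \<subseteq> carrier G" using P by (simp add: prob_measure_on_def)
  have "measure_pmf.expectation P (\<lambda>x. indicator {y} x * ?h y) \<le> measure_pmf.expectation P ?h"
  proof (rule integral_mono_AE)
    show "integrable (measure_pmf P) ?h"
      using bounded_harmonicD(1)[OF P D g] by simp
    show "AE x in measure_pmf P. indicator {y} x * ?h y \<le> ?h x"
      using le g yG by (auto simp: AE_measure_pmf_iff indicator_def)
    show "integrable (measure_pmf P) (\<lambda>x. indicator {y} x * ?h y)"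
      by (auto intro!: integrable_real_indicator simp: less_top[symmetric])
  qed
  also have "\<dots> = s - D g"
    using bounded_harmonicD[OF P D g] by simp
  finally have "pmf P y * ?h y \<le> s - D g"
    by (simp add: measure_pmf_single)
  moreover have "0 < pmf P y" using y by (simp add: pmf_positive)
  ultimately show ?thesis by (simp add: field_simps)
qed

text \<open>The constant depends on the word \<open>w\<close> alone, not on \<open>D\<close>, \<open>s\<close> or \<open>g\<close>: for finitely many words, one point
sufficiently close to the supremum works for all of them.\<close>

lemma near_maximum_propagates:
  assumes P: "prob_measure_on G P" and w: "w \<in> submonoid_span G (set_pmf P)"
  shows "\<exists>c>0. \<forall>D\<in>bounded_harmonic P. \<forall>s. (\<forall>x\<in>carrier G. D x \<le> s) \<longrightarrow>
    (\<forall>g\<in>carrier G. s - D (g \<otimes> inv w) \<le> c * (s - D g))"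
  using w
proof induction
  case one
  show ?case by (rule exI[of _ 1]) auto
next
  case (incl y)
  then have "0 < pmf P y" by (simp add: pmf_positive)
  then show ?case
    using near_maximum_step[OF P _ _ _ incl]
    by (intro exI[of _ "1 / pmf P y"]) auto
next
  case (mult x y)
  interpret submonoid "submonoid_span G (set_pmf P)" G
    using P by (intro submonoid_span_submonoid) (simp add: prob_measure_on_def)
  have carr: "x \<in> carrier G" "y \<in> carrier G" using mult.hyps by auto
  obtain c where c: "c > 0" "\<And>D s g. D \<in> bounded_harmonic P \<Longrightarrow> \<forall>x\<in>carrier G. D x \<le> s \<Longrightarrow>
      g \<in> carrier G \<Longrightarrow> s - D (g \<otimes> inv x) \<le> c * (s - D g)"
    using mult.IH(1) by blast
  obtain d where d: "d > 0" "\<And>D s g. D \<in> bounded_harmonic P \<Longrightarrow> \<forall>x\<in>carrier G. D x \<le> s \<Longrightarrow>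
      g \<in> carrier G \<Longrightarrow> s - D (g \<otimes> inv y) \<le> d * (s - D g)"
    using mult.IH(2) by blast
  show ?case
  proof (intro exI[of _ "c * d"] conjI ballI allI impI)
    show "0 < c * d" using c d by simp
  next
    fix D s g assume D: "D \<in> bounded_harmonic P" "\<forall>x\<in>carrier G. D x \<le> s" and g: "g \<in> carrier G"
    have "s - D (g \<otimes> inv (x \<otimes> y)) = s - D ((g \<otimes> inv y) \<otimes> inv x)"
      using carr g by (simp add: inv_mult_group m_assoc)
    also have "\<dots> \<le> c * (s - D (g \<otimes> inv y))"
      using c(2)[OF D] carr g by simp
    also have "\<dots> \<le> c * (d * (s - D g))"
      using d(2)[OF D g] c(1) by simp
    finally show "s - D (g \<otimes> inv (x \<otimes> y)) \<le> c * d * (s - D g)" by (simp add: mult.assoc)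
  qed
qed

text \<open>The kernel of the action of the group on its bounded harmonic functions by left translation, which
in the language of boundary theory is the kernel of the action on the Poisson boundary.\<close>

definition harmonic_periods :: "'a pmf \<Rightarrow> 'a set" where
  "harmonic_periods P =
     {h \<in> carrier G. \<forall>f\<in>bounded_harmonic P. \<forall>g\<in>carrier G. f (h \<otimes> g) = f g}"

text \<open>The Choquet-Deny argument with two words instead of one. Writing \<open>a = z b\<close>, the words
\<open>w\<^sub>i = a\<^sup>i b\<^sup>n\<^sup>-\<^sup>i\<close> all have the same length in \<open>a\<close> and \<open>b\<close>, and modulo periods \<open>w\<^sub>i\<close> is
\<open>z\<^sup>i b\<^sup>n\<close>. The increments of \<open>f\<close> along \<open>z\<close> at the points \<open>g w\<^sub>i\<inverse>\<close> therefore
telescope, and boundedness of \<open>f\<close> forbids all of them to exceed half of a positive supremum once \<open>n\<close>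
is large.\<close>

lemma quotient_increment_nonpos:
  assumes P: "prob_measure_on G P"
    and ab: "a \<in> submonoid_span G (set_pmf P)" "b \<in> submonoid_span G (set_pmf P)"
    and z: "z = a \<otimes> inv b"
    and comm: "\<And>g. g \<in> carrier G \<Longrightarrow> z \<otimes> g \<otimes> inv z \<otimes> inv g \<in> harmonic_periods P"
    and f: "f \<in> bounded_harmonic P" and g0: "g0 \<in> carrier G"
  shows "f (z \<otimes> g0) - f g0 \<le> 0"
proof (rule ccontr)
  assume "\<not> ?thesis"
  then have pos: "f (z \<otimes> g0) - f g0 > 0" by simp
  let ?S = "submonoid_span G (set_pmf P)"
  interpret S: submonoid ?S G
    using P by (intro submonoid_span_submonoid) (simp add: prob_measure_on_def)
  have carr: "a \<in> carrier G" "b \<in> carrier G" "z \<in> carrier G" using ab z by auto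
  define D where "D g = f (z \<otimes> g) - f g" for g
  have D: "D \<in> bounded_harmonic P"
    unfolding D_def using bounded_harmonic_diff[OF P bounded_harmonic_left_translate[OF P f carr(3)] f] .
  define s where "s = (SUP g\<in>carrier G. D g)"
  have bdd: "bdd_above (D ` carrier G)"
    using D by (auto simp: bounded_harmonic_def intro: bounded_imp_bdd_above)
  have le: "\<forall>g\<in>carrier G. D g \<le> s"
    unfolding s_def using bdd by (auto intro: cSUP_upper)
  have s0: "s > 0" using le g0 pos unfolding D_def by force
  obtain B where B: "\<And>g. g \<in> carrier G \<Longrightarrow> \<bar>f g\<bar> \<le> B"
    using f by (auto simp: bounded_harmonic_def bounded_iff)
  obtain n :: nat where n: "2 * B < real n * (s / 2)"
    using s0 by (metis half_gt_zero reals_Archimedean3)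
  define w where "w i = a [^] i \<otimes> b [^] (n - i)" for i :: nat
  have pow: "x [^] (k::nat) \<in> ?S" if "x \<in> ?S" for x k
    by (induction k) (use that in auto)
  have wS: "w i \<in> ?S" for i
    unfolding w_def using pow[OF ab(1)] pow[OF ab(2)] by (rule S.m_closed)
  then obtain c where c: "\<And>i. c i > 0" "\<And>i g. g \<in> carrier G \<Longrightarrow> s - D (g \<otimes> inv (w i)) \<le> c i * (s - D g)"
    using near_maximum_propagates[OF P wS] D le by metis
  define C where "C = (\<Sum>i\<le>n. c i)"
  have C: "c i \<le> C" if "i \<le> n" for i
    unfolding C_def using that c(1) by (intro member_le_sum) (auto simp: less_imp_le)
  have C0: "C > 0" using C[of 0] c(1)[of 0] by simp
  \<comment> \<open>A deficit of \<open>s / (2 C)\<close> at \<open>g\<close> becomes at most \<open>s / 2\<close> after propagation along any \<open>w i\<close>.\<close>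
  have "s - s / (2 * C) < s" using s0 C0 by simp
  then obtain g where g: "g \<in> carrier G" "s - s / (2 * C) < D g"
    unfolding s_def using less_cSUP_iff[OF _ bdd] g0 by blast
  have near: "s / 2 \<le> D (g \<otimes> inv (w i))" if "i \<le> n" for i
  proof -
    have "s - D (g \<otimes> inv (w i)) \<le> c i * (s - D g)" by (rule c(2)[OF g(1)])
    also have "\<dots> \<le> C * (s / (2 * C))"
      using C[OF that] C0 g le c(1)[of i] by (intro mult_mono) auto
    also have "\<dots> = s / 2" using C0 by simp
    finally show ?thesis by simp
  qed
  have wG: "w i \<in> carrier G" for i using wS by auto
  \<comment> \<open>Passing from \<open>w i\<close> to \<open>w (Suc i)\<close> turns one factor \<open>b\<close> into \<open>a = z b\<close>; its \<open>z\<inverse>\<close> cancels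
    the \<open>z\<close> in front once \<open>z\<close> has been moved past \<open>p\<close>, at the cost of a commutator in the periods.\<close>
  have shift: "f (z \<otimes> (g \<otimes> inv (w (Suc i)))) = f (g \<otimes> inv (w i))" if i: "i < n" for i
  proof -
    define p where "p = g \<otimes> inv (b [^] (n - i))"
    define q where "q = inv (a [^] i)"
    have pq: "p \<in> carrier G" "q \<in> carrier G" using g carr by (auto simp: p_def q_def)
    have az: "a = z \<otimes> b" using z carr(1,2) by (simp add: m_assoc)
    obtain m where m: "n - i = Suc m" "n - Suc i = m" using i by (metis Suc_diff_Suc)
    have bm: "b [^] m \<otimes> b = b \<otimes> b [^] m"
      using nat_pow_Suc2[OF carr(2)] by simp
    have "w (Suc i) = a [^] i \<otimes> (z \<otimes> b [^] (n - i))"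
      unfolding w_def m using carr bm by (simp add: m_assoc az)
    then have "z \<otimes> (g \<otimes> inv (w (Suc i))) = (z \<otimes> p \<otimes> inv z) \<otimes> q"
      using carr g by (simp add: p_def q_def inv_mult_group m_assoc)
    also have "\<dots> = (z \<otimes> p \<otimes> inv z \<otimes> inv p) \<otimes> (p \<otimes> q)"
      using carr(3) pq by (simp add: m_assoc mult_inv_cancel_left)
    finally have "f (z \<otimes> (g \<otimes> inv (w (Suc i)))) = f (p \<otimes> q)"
      using comm[OF pq(1)] f pq by (auto simp: harmonic_periods_def)
    moreover have "p \<otimes> q = g \<otimes> inv (w i)"
      using carr g by (simp add: p_def q_def w_def inv_mult_group m_assoc)
    ultimately show ?thesis by simp
  qed
  have "real n * (s / 2) \<le> (\<Sum>i<n. D (g \<otimes> inv (w (Suc i))))"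
    using sum_mono[of "{..<n}" "\<lambda>_. s / 2" "\<lambda>i. D (g \<otimes> inv (w (Suc i)))"] near by simp
  also have "\<dots> = (\<Sum>i<n. f (g \<otimes> inv (w i)) - f (g \<otimes> inv (w (Suc i))))"
    by (rule sum.cong) (auto simp: D_def shift)
  also have "\<dots> = f (g \<otimes> inv (w 0)) - f (g \<otimes> inv (w n))"
    by (rule sum_lessThan_telescope')
  also have "\<dots> \<le> 2 * B"
    using B[of "g \<otimes> inv (w 0)"] B[of "g \<otimes> inv (w n)"] g(1) wG by (simp add: abs_le_iff)
  finally show False using n by simp
qed

text \<open>The increments of \<open>f\<close> along \<open>z\<close> are nonpositive, and so are those of the bounded harmonic
function \<open>-f\<close>.\<close>

lemma quotient_mem_harmonic_periods:
  assumes P: "prob_measure_on G P"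
    and ab: "a \<in> submonoid_span G (set_pmf P)" "b \<in> submonoid_span G (set_pmf P)"
    and z: "z = a \<otimes> inv b"
    and comm: "\<And>g. g \<in> carrier G \<Longrightarrow> z \<otimes> g \<otimes> inv z \<otimes> inv g \<in> harmonic_periods P"
  shows "z \<in> harmonic_periods P"
proof -
  interpret S: submonoid "submonoid_span G (set_pmf P)" G
    using P by (intro submonoid_span_submonoid) (simp add: prob_measure_on_def)
  have zG: "z \<in> carrier G" using ab z by simp
  have le: "f (z \<otimes> g) \<le> f g" if "f \<in> bounded_harmonic P" "g \<in> carrier G" for f g
    using quotient_increment_nonpos[OF P ab z comm that] by simp
  have zero: "(\<lambda>g. 0) \<in> bounded_harmonic P"
    by (rule bounded_harmonicI[OF P]) (auto simp: bounded_iff)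
  have "f (z \<otimes> g) = f g" if f: "f \<in> bounded_harmonic P" and g: "g \<in> carrier G" for f g
    using le[OF f g] le[OF bounded_harmonic_diff[OF P zero f] g] by simp
  then show ?thesis using zG by (simp add: harmonic_periods_def)
qed

text \<open>Commutator induction: when the commutators of \<open>z \<in> N\<close> are known to be periods, \<open>z\<close> is central modulo
periods, and it is a quotient of words in the support of \<open>P\<close> by the Ore condition.\<close>

lemma hypercentral_subgroup_subset_harmonic_periods:
  assumes P: "prob_measure_on G P"
    and N: "N \<lhd> G" "N \<subseteq> hypercentre G"
    and gen: "generate G (set_pmf P \<inter> N) = N"
  shows "N \<subseteq> harmonic_periods P"
proof
  interpret N: normal N G by (rule N)
  let ?S = "submonoid_span G (set_pmf P \<inter> N)"
  have S: "submonoid ?S G"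
    by (rule submonoid_span_submonoid) (use N.subset in blast)
  have SN: "?S \<subseteq> N"
    by (rule submonoid_span_least[OF N.subgroup_is_submonoid]) blast
  have S_mono: "x \<in> submonoid_span G (set_pmf P)" if "x \<in> ?S" for x
    using that by induction (auto intro: submonoid_span.intros)
  have "N \<subseteq> generate G ?S"
    using mono_generate[of "set_pmf P \<inter> N" ?S] gen by (auto intro: submonoid_span.incl)
  then have quot: "\<exists>a\<in>?S. \<exists>b\<in>?S. z = a \<otimes> inv b" if "z \<in> N" for z
    using generate_eq_quotients[OF N.subgroup_axioms N(2) S SN] that by blast
  fix z assume "z \<in> N"
  then have "z \<in> hypercentre G" using N(2) by blast
  then have "z \<in> N \<longrightarrow> z \<in> harmonic_periods P"
  proof (induction z rule: hypercentre_induct)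
    case one
    show ?case by (simp add: harmonic_periods_def)
  next
    case (commutator z)
    show ?case
    proof
      assume z: "z \<in> N"
      obtain a b where ab: "a \<in> ?S" "b \<in> ?S" "z = a \<otimes> inv b" using quot[OF z] by blast
      have "z \<otimes> g \<otimes> inv z \<otimes> inv g \<in> N" if g: "g \<in> carrier G" for g
      proof -
        have "z \<otimes> (g \<otimes> inv z \<otimes> inv g) \<in> N"
          by (intro N.m_closed N.inv_op_closed2 N.m_inv_closed z g)
        then show ?thesis using commutator(1) g by (simp add: m_assoc)
      qed
      then show "z \<in> harmonic_periods P"
        using quotient_mem_harmonic_periods[OF P S_mono S_mono] ab commutator(2) by metis
    qed
  qed
  then show "z \<in> harmonic_periods P" using \<open>z \<in> N\<close> by blast
qed

section \<open>Lazy versions and quotients\<close>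

text \<open>The defect \<open>f * P - f\<close> is \<open>1 - t\<close> times the defect \<open>f * Q - f\<close>, and \<open>1 - t > 0\<close>.\<close>

lemma lazy_version_harmonic_iff:
  assumes P: "prob_measure_on G P" and Q: "prob_measure_on G Q"
    and lazy: "lazy_version G P Q" and f: "bounded (f ` carrier G)"
  shows "harmonic G P f \<longleftrightarrow> harmonic G Q f"
proof -
  obtain t :: real where t: "0 \<le> t" "t < 1"
    "\<And>x. x \<in> carrier G \<Longrightarrow> pmf P x = t * pmf (return_pmf \<one>) x + (1 - t) * pmf Q x"
    using lazy by (auto simp: lazy_version_def)
  have "conv_fun G f P g = t * f g + (1 - t) * conv_fun G f Q g" if g: "g \<in> carrier G" for g
  proof -
    let ?h = "\<lambda>y. f (g \<otimes> inv y)"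
    note sum = bounded_pmf_has_sum[OF bounded_translate[OF f g]]
    have "((\<lambda>y. t * (?h y * pmf (return_pmf \<one>) y) + (1 - t) * (?h y * pmf Q y)) has_sum
        t * measure_pmf.expectation (return_pmf \<one>) ?h + (1 - t) * measure_pmf.expectation Q ?h)
        (carrier G)"
      by (intro has_sum_add has_sum_cmult_right sum) (use Q in \<open>auto simp: prob_measure_on_def\<close>)
    then have "((\<lambda>y. ?h y * pmf P y) has_sum t * f g + (1 - t) * measure_pmf.expectation Q ?h)
        (carrier G)"
      using g by (subst has_sum_cong[where g = "\<lambda>y. t * (?h y * pmf (return_pmf \<one>) y)
        + (1 - t) * (?h y * pmf Q y)"]) (auto simp: t(3) algebra_simps)
    then show ?thesis
      unfolding conv_fun_eq_expectation[OF f Q g] unfolding conv_fun_def by (rule infsumI)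
  qed
  then have "conv_fun G f P g = f g \<longleftrightarrow> conv_fun G f Q g = f g" if "g \<in> carrier G" for g
  proof -
    have "conv_fun G f P g - f g = (1 - t) * (conv_fun G f Q g - f g)"
      using \<open>\<And>g. g \<in> carrier G \<Longrightarrow> conv_fun G f P g = _\<close>[OF that] by (simp add: algebra_simps)
    then show ?thesis using t(2) by auto
  qed
  then show ?thesis by (simp add: harmonic_def)
qed

lemma lazy_version_liouville_iff:
  assumes "prob_measure_on G P" "prob_measure_on G Q" "lazy_version G P Q"
  shows "liouville G P \<longleftrightarrow> liouville G Q"
  using lazy_version_harmonic_iff[OF assms] by (auto simp: liouville_def)

end

context normal
begin

lemma carrier_FactGroup_eq_image: "carrier (G Mod H) = (\<lambda>x. H #> x) ` carrier G"
  by (auto simp: FactGroup_def RCOSETS_def)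

lemma prob_measure_on_pushforward:
  assumes "prob_measure_on G P"
  shows "prob_measure_on (G Mod H) (map_pmf (\<lambda>x. H #> x) P)"
  using assms by (auto simp: prob_measure_on_def carrier_FactGroup_eq_image)

lemma harmonic_pushforward_iff:
  assumes P: "prob_measure_on G P" and F: "bounded (F ` carrier (G Mod H))"
  shows "harmonic (G Mod H) (map_pmf (\<lambda>x. H #> x) P) F \<longleftrightarrow> harmonic G P (\<lambda>x. F (H #> x))"
proof -
  interpret Q: group "G Mod H" by (rule factorgroup_is_group)
  interpret h: group_hom G "G Mod H" "\<lambda>x. H #> x"
    using r_coset_hom_Mod by unfold_locales
  have bdd: "bounded ((\<lambda>x. F (H #> x)) ` carrier G)"
    using F by (simp add: carrier_FactGroup_eq_image image_image)
  have "conv_fun (G Mod H) F (map_pmf (\<lambda>x. H #> x) P) (H #> g)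
      = conv_fun G (\<lambda>x. F (H #> x)) P g" if g: "g \<in> carrier G" for g
  proof -
    have "conv_fun (G Mod H) F (map_pmf (\<lambda>x. H #> x) P) (H #> g)
        = measure_pmf.expectation P (\<lambda>y. F ((H #> g) \<otimes>\<^bsub>G Mod H\<^esub> inv\<^bsub>G Mod H\<^esub> (H #> y)))"
      using Q.conv_fun_eq_expectation[OF F prob_measure_on_pushforward[OF P] h.hom_closed[OF g]]
      by simp
    also have "\<dots> = measure_pmf.expectation P (\<lambda>y. F (H #> (g \<otimes> inv y)))"
      by (rule integral_cong_AE)
        (use P g in \<open>auto simp: AE_measure_pmf_iff prob_measure_on_def simp flip: h.hom_inv h.hom_mult
          simp del: mult_FactGroup\<close>)
    also have "\<dots> = conv_fun G (\<lambda>x. F (H #> x)) P g"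
      by (rule conv_fun_eq_expectation[OF bdd P g, symmetric])
    finally show ?thesis .
  qed
  then show ?thesis by (simp add: harmonic_def carrier_FactGroup_eq_image)
qed

text \<open>Harmonic functions on the quotient always pull back. Conversely, a harmonic function on \<open>G\<close>
descends because it is constant on the cosets of its periods.\<close>

lemma liouville_pushforward_iff:
  assumes P: "prob_measure_on G P" and periods: "H \<subseteq> harmonic_periods P"
  shows "liouville G P \<longleftrightarrow> liouville (G Mod H) (map_pmf (\<lambda>x. H #> x) P)"
proof
  assume L: "liouville G P"
  show "liouville (G Mod H) (map_pmf (\<lambda>x. H #> x) P)"
    unfolding liouville_def
  proof (intro allI impI)
    fix F :: "'a set \<Rightarrow> real"
    assume F: "bounded (F ` carrier (G Mod H))" "harmonic (G Mod H) (map_pmf (\<lambda>x. H #> x) P) F"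
    have "bounded ((\<lambda>x. F (H #> x)) ` carrier G)"
      using F(1) by (simp add: carrier_FactGroup_eq_image image_image)
    moreover have "harmonic G P (\<lambda>x. F (H #> x))"
      using harmonic_pushforward_iff[OF P F(1)] F(2) by blast
    ultimately obtain c where "\<forall>x\<in>carrier G. F (H #> x) = c"
      using L unfolding liouville_def by meson
    then show "\<exists>c. \<forall>x\<in>carrier (G Mod H). F x = c"
      by (auto simp: carrier_FactGroup_eq_image)
  qed
next
  assume L: "liouville (G Mod H) (map_pmf (\<lambda>x. H #> x) P)"
  show "liouville G P"
    unfolding liouville_def
  proof (intro allI impI)
    fix f :: "'a \<Rightarrow> real"
    assume f: "bounded (f ` carrier G)" "harmonic G P f"
    define F where "F C = f (SOME x. x \<in> C)" for C
    have F: "F (H #> x) = f x" if x: "x \<in> carrier G" for x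
    proof -
      have "x \<in> H #> x" using x by (rule rcos_self[OF _ subgroup_axioms])
      then have "(SOME y. y \<in> H #> x) \<in> H #> x" by (rule someI)
      then obtain h where "h \<in> H" "(SOME y. y \<in> H #> x) = h \<otimes> x"
        by (auto simp: r_coset_def)
      then show ?thesis
        using periods f x by (auto simp: F_def harmonic_periods_def bounded_harmonic_def)
    qed
    have img: "F ` carrier (G Mod H) = f ` carrier G"
      using F by (auto simp: carrier_FactGroup_eq_image image_image)
    have bdd: "bounded (F ` carrier (G Mod H))" using f(1) img by simp
    have "conv_fun G (\<lambda>x. F (H #> x)) P g = conv_fun G f P g" if "g \<in> carrier G" for g
      unfolding conv_fun_def by (rule infsum_cong) (use that F in simp)
    then have "harmonic G P (\<lambda>x. F (H #> x))"
      using f(2) F by (simp add: harmonic_def)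
    then have "harmonic (G Mod H) (map_pmf (\<lambda>x. H #> x) P) F"
      using harmonic_pushforward_iff[OF P bdd] by blast
    then obtain c where "\<forall>C\<in>carrier (G Mod H). F C = c"
      using L bdd unfolding liouville_def by meson
    then show "\<exists>c. \<forall>x\<in>carrier G. f x = c"
      using F by (auto simp: carrier_FactGroup_eq_image)
  qed
qed

end

theorem theorem3p6:
  fixes \<Gamma> :: "('a, 'b) monoid_scheme"
    and N :: "'a set"
    and \<mu> :: "'a pmf"
    and \<nu> :: "'a set pmf"
  assumes "group \<Gamma>"
    and "countable (carrier \<Gamma>)"
    and "N \<lhd> \<Gamma>"
    and "N \<subseteq> hypercentre \<Gamma>"
    and "prob_measure_on (\<Gamma> Mod N) \<nu>"
    and "finite (set_pmf \<nu>)"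
    and "symmetric_measure (\<Gamma> Mod N) \<nu>"
    and "generate (\<Gamma> Mod N) (set_pmf \<nu>) = carrier (\<Gamma> Mod N)"
    and "prob_measure_on \<Gamma> \<mu>"
    and "generate \<Gamma> (set_pmf \<mu> \<inter> N) = N"
    and "lazy_version (\<Gamma> Mod N) (map_pmf (\<lambda>x. N #>\<^bsub>\<Gamma>\<^esub> x) \<mu>) \<nu>"
    and "(\<exists>S. finite S \<and> S \<subseteq> N \<and> generate \<Gamma> S = N) \<or>
         (\<exists>n\<ge>1. \<forall>\<kappa>\<in>Field (ordinals_for \<Gamma>).
            generate \<Gamma> (set_pmf (conv_power \<Gamma> \<mu> n) \<inter> N \<inter> upper_central \<Gamma> \<kappa>)
              = N \<inter> upper_central \<Gamma> \<kappa>)"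
  shows "liouville \<Gamma> \<mu> \<longleftrightarrow> liouville (\<Gamma> Mod N) \<nu>"
proof -
  interpret group \<Gamma> by fact
  interpret N: normal N \<Gamma> by fact
  let ?P = "map_pmf (\<lambda>x. N #>\<^bsub>\<Gamma>\<^esub> x) \<mu>"
  have "liouville \<Gamma> \<mu> \<longleftrightarrow> liouville (\<Gamma> Mod N) ?P"
    by (intro N.liouville_pushforward_iff hypercentral_subgroup_subset_harmonic_periods assms)
  also have "\<dots> \<longleftrightarrow> liouville (\<Gamma> Mod N) \<nu>"
    by (intro group.lazy_version_liouville_iff N.factorgroup_is_group
        N.prob_measure_on_pushforward assms)
  finally show ?thesis .
qed

end
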